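(* Let $c\in\mathbb{C}^n$ be generic and let $\{\phi^k:k=1,\dots,\mathrm{vol}(A)\}$ be a basis of canonical series solutions of the $A$-hypergeometric system $H_A(A\cdot c)$. Then there exist linearly independent, fully supported solutions $\{\psi^k_l:k=1,\dots,\mathrm{vol}(A),\ l=1,\dots,g\}$ of $\mathrm{Horn}(\mathcal{B},c)$ with pairwise disjoint supports such that \[\phi^k=x^c\sum_{l=1}^g\psi^k_l(x^{\mathcal{B}})\quad\text{for all }k=1,\dots,\mathrm{vol}(A).\] Moreover, no nontrivial linear combination of the functions $\psi^k_l$ is a Puiseux polynomial.
   Context: $n>m$; $\mathcal{B}=(b_{ji})\in\mathbb{Z}^{n\times m}$ of rank $m$, rows $b_j$ summing to zero, columns $b^{(i)}$; $A=(a_{kj})\in\mathbb{Z}^{(n-m)\times n}$ of rank $n-m$, first row all ones, $A\mathcal{B}=0$; $g$ = positive gcd of the maximal minors of $\mathcal{B}$ (so $|\ker_\mathbb{Z}A/\mathcal{B}\mathbb{Z}^m|=g$); $\mathrm{vol}(A)$ = normalized volume of the convex hull of the columns of $A$. $H_A(\beta)=D_nI_A+D_n\langle\sum_ja_{kj}x_j\partial_j-\beta_k\rangle$, $I_A=\langle\partial^{u_+}-\partial^{u_-}:u\in\ker_\mathbb{Z}A\rangle$. For generic $c$, the canonical series solutions (with respect to a generic weight vector, in the sense of Saito–Sturmfels–Takayama) are $\mathrm{vol}(A)$ logarithm-free series $\phi^k=x^{\alpha_k}\sum_{u\in\ker_\mathbb{Z}A\cap C_k}\lambda_ux^u$ with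 $A\alpha_k=Ac$, $C_k$ full-dimensional pointed cones, and no two $\alpha_k$ differing by an integer vector. $\mathrm{Horn}(\mathcal{B},c)=D_m\langle H_1,\dots,H_m\rangle$ with $H_i=Q_i-y_iP_i$, $P_i=\prod_{j:b_{ji}<0}\prod_{l=0}^{|b_{ji}|-1}(b_j\cdot\theta_y+c_j-l)$, $Q_i=\prod_{j:b_{ji}>0}\prod_{l=0}^{b_{ji}-1}(b_j\cdot\theta_y+c_j-l)$, $b_j\cdot\theta_y=\sum_kb_{jk}y_k\partial_{y_k}$. $x^{\mathcal{B}}=(x^{b^{(1)}},\dots,x^{b^{(m)}})$. A series is fully supported if the convex hull of the exponents of its monomials with nonzero coefficients contains a full-dimensional cone. Generic $c$: outside an exceptional measure-zero set. *)

theory Defs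
  imports "HOL-Analysis.Analysis"
begin

text \<open>Formal (generalized) power series in several variables with complex exponents are
represented by their coefficient functions: a series in variables indexed by 'n is a
function (complex^'n => complex), mapping an exponent vector v to the coefficient of x^v.\<close>

definition supp :: "('a \<Rightarrow> complex) \<Rightarrow> 'a set" where
  "supp f = {v. f v \<noteq> 0}"

definition mat_cvec :: "int^'m^'n \<Rightarrow> complex^'m \<Rightarrow> complex^'n" where
  "mat_cvec M v = (\<chi> j. \<Sum>k\<in>UNIV. of_int (M$j$k) * v$k)"

definition int_to_cvec :: "int^'n \<Rightarrow> complex^'n" where
  "int_to_cvec u = (\<chi> j. of_int (u$j))"

definition int_to_rvec :: "int^'n \<Rightarrow> real^'n" where
  "int_to_rvec u = (\<chi> j. real_of_int (u$j))"

definition ffact :: "complex \<Rightarrow> nat \<Rightarrow> complex" where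
  "ffact a k = (\<Prod>i<k. a - of_nat i)"

text \<open>action of the monomial differential operator \<partial>^w on a formal series\<close>
definition dmon :: "nat^'n \<Rightarrow> (complex^'n \<Rightarrow> complex) \<Rightarrow> (complex^'n \<Rightarrow> complex)" where
  "dmon w f = (\<lambda>v. f (v + (\<chi> j. of_nat (w$j))) * (\<Prod>j\<in>UNIV. ffact (v$j + of_nat (w$j)) (w$j)))"

definition pos_part :: "int^'n \<Rightarrow> nat^'n" where
  "pos_part u = (\<chi> j. nat (u$j))"

definition neg_part :: "int^'n \<Rightarrow> nat^'n" where
  "neg_part u = (\<chi> j. nat (- u$j))"

definition kerZ :: "int^'n^'d \<Rightarrow> (int^'n) set" where
  "kerZ A = {u. A *v u = 0}"

text \<open>f is a (formal) solution of H_A(beta): annihilated by the generators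
  d^{u+} - d^{u-} (u in ker_Z A) of I_A and by the Euler operators.\<close>
definition is_A_hyp_sol :: "int^'n^'d \<Rightarrow> complex^'d \<Rightarrow> (complex^'n \<Rightarrow> complex) \<Rightarrow> bool" where
  "is_A_hyp_sol A \<beta> f \<longleftrightarrow>
     (\<forall>u\<in>kerZ A. dmon (pos_part u) f = dmon (neg_part u) f) \<and>
     (\<forall>k v. ((\<Sum>j\<in>UNIV. of_int (A$k$j) * v$j) - \<beta>$k) * f v = 0)"

text \<open>Horn system Horn(B,c): b_j . theta_y + c_j acts on y^v by the scalar hornL\<close>
definition hornL :: "int^'m^'n \<Rightarrow> complex^'n \<Rightarrow> 'n \<Rightarrow> complex^'m \<Rightarrow> complex" where
  "hornL B c j v = (\<Sum>k\<in>UNIV. of_int (B$j$k) * v$k) + c$j"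

definition hornP :: "int^'m^'n \<Rightarrow> complex^'n \<Rightarrow> 'm \<Rightarrow> complex^'m \<Rightarrow> complex" where
  "hornP B c i v = (\<Prod>j\<in>{j. B$j$i < 0}. ffact (hornL B c j v) (nat (- B$j$i)))"

definition hornQ :: "int^'m^'n \<Rightarrow> complex^'n \<Rightarrow> 'm \<Rightarrow> complex^'m \<Rightarrow> complex" where
  "hornQ B c i v = (\<Prod>j\<in>{j. B$j$i > 0}. ffact (hornL B c j v) (nat (B$j$i)))"

text \<open>(H_i psi) has coefficient Q_i(v) psi(v) - P_i(v - e_i) psi(v - e_i) at y^v\<close>
definition is_horn_sol :: "int^'m^'n \<Rightarrow> complex^'n \<Rightarrow> (complex^'m \<Rightarrow> complex) \<Rightarrow> bool" where
  "is_horn_sol B c \<psi> \<longleftrightarrow>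
     (\<forall>i v. hornQ B c i v * \<psi> v - hornP B c i (v - axis i 1) * \<psi> (v - axis i 1) = 0)"

definition fully_supported :: "(complex^'m \<Rightarrow> complex) \<Rightarrow> bool" where
  "fully_supported \<psi> \<longleftrightarrow>
     (\<exists>p::complex^'m. \<exists>K::(real^'m) set. convex K \<and> cone K \<and> interior K \<noteq> {} \<and>
        (\<lambda>w. p + (\<chi> i. complex_of_real (w$i))) ` K \<subseteq> convex hull (supp \<psi>))"

definition puiseux_poly :: "('a \<Rightarrow> complex) \<Rightarrow> bool" where
  "puiseux_poly f \<longleftrightarrow> finite (supp f)"

definition lin_indep_on :: "'i set \<Rightarrow> ('i \<Rightarrow> 'a \<Rightarrow> complex) \<Rightarrow> bool" where
  "lin_indep_on I F \<longleftrightarrow>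
     (\<forall>\<mu>. (\<forall>v. (\<Sum>i\<in>I. \<mu> i * F i v) = 0) \<longrightarrow> (\<forall>i\<in>I. \<mu> i = 0))"

text \<open>x^c psi(x^B): the monomial y^v becomes x^(c + B v) (B injective as rank B = m)\<close>
definition subst_xB :: "int^'m^'n \<Rightarrow> complex^'n \<Rightarrow> (complex^'m \<Rightarrow> complex) \<Rightarrow> (complex^'n \<Rightarrow> complex)" where
  "subst_xB B c \<psi> = (\<lambda>w. if \<exists>v. w = c + mat_cvec B v
                          then \<psi> (SOME v. w = c + mat_cvec B v) else 0)"

definition horn_g :: "int^'m^'n \<Rightarrow> nat" where
  "horn_g B = nat (Gcd {det (\<chi> i k. B$(f i)$k) | f :: 'm \<Rightarrow> 'n. inj f})"

text \<open>normalized volume of conv(A), with respect to the lattice ZA: for A whose first row is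
  all ones, (d-1)! vol_{d-1}(conv A) = d! vol_d(conv({0} \<union> A)), divided by the index [Z^d : ZA],
  which is the gcd of the maximal minors of A.\<close>
definition volA :: "int^'n^'d \<Rightarrow> nat" where
  "volA A = nat (round (fact CARD('d)
       * measure lborel (convex hull (insert 0 {(\<chi> k. real_of_int (A$k$j)) | j. True}))
       / real_of_int (Gcd {det (\<chi> i k. A$i$(f k)) | f :: 'd \<Rightarrow> 'n. inj f})))"

definition canonical_basis ::
  "int^'n^'d \<Rightarrow> complex^'n \<Rightarrow> (nat \<Rightarrow> complex^'n \<Rightarrow> complex) \<Rightarrow> (nat \<Rightarrow> complex^'n)
     \<Rightarrow> (nat \<Rightarrow> (real^'n) set) \<Rightarrow> bool" where
  "canonical_basis A c \<phi> \<alpha> C \<longleftrightarrow>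
     (\<forall>k\<in>{1..volA A}.
        is_A_hyp_sol A (mat_cvec A c) (\<phi> k) \<and>
        mat_cvec A (\<alpha> k) = mat_cvec A c \<and>
        convex (C k) \<and> cone (C k) \<and> interior (C k) \<noteq> {} \<and> C k \<inter> uminus ` C k \<subseteq> {0} \<and>
        supp (\<phi> k) \<subseteq> {\<alpha> k + int_to_cvec u | u. u \<in> kerZ A \<and> int_to_rvec u \<in> C k}) \<and>
     (\<forall>k\<in>{1..volA A}. \<forall>k'\<in>{1..volA A}. k \<noteq> k' \<longrightarrow>
        \<not> (\<exists>z. \<alpha> k - \<alpha> k' = int_to_cvec z)) \<and>
     lin_indep_on {1..volA A} \<phi>"

end

theory Submission
  imports Defs
begin

text \<open>
  Substituting \<open>v \<mapsto> c + B v\<close> turns the binomial equation of a column of \<open>B\<close> into the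
  corresponding Horn equation, which only relates exponents in one coset of \<open>B \<int>\<^sup>m\<close>. Hence the part
  of \<open>\<phi>\<^sup>k\<close> supported on a union of cosets is a Horn solution, and one only needs that \<open>ker\<^sub>\<int> A\<close>
  contains at least \<open>g\<close> cosets: surplus ones can be merged.

  The lower bound on the number of cosets goes by induction on the prime factors of a common divisor of the
  maximal minors. If a prime \<open>p\<close> divides all minors, some \<open>x\<close> with an entry \<open>1\<close> satisfies \<open>B x \<equiv> 0\<close>
  modulo \<open>p\<close>, and replacing a column of \<open>B\<close> by \<open>B x / p\<close> divides all maximal minors by \<open>p\<close> while
  enlarging the lattice by index \<open>p\<close>.

  For full support: if \<open>w\<close> lies in the support of an \<open>A\<close>-hypergeometric series, then so does
  \<open>w + u\<close> for every \<open>u \<in> ker\<^sub>\<int> A\<close> that is nonnegative in the coordinates \<open>j\<close> with \<open>w\<^sub>j \<in> \<int>\<close>.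
  For \<open>c\<close> outside countably many hyperplanes the rows \<open>b\<^sub>j\<close> for these coordinates are linearly
  independent, so the conditions \<open>b\<^sub>j \<cdot> x \<ge> 0\<close> cut out a full-dimensional cone.
\<close>

section \<open>Cosets of the column lattice\<close>

text \<open>Cramer's identity over a commutative ring: expand column \<open>k\<close> linearly in
  the columns of \<open>A\<close>; every term with \<open>l \<noteq> k\<close> has two equal
  columns. It controls the maximal minors when a column of \<open>B\<close> is replaced.\<close>

lemma det_replace_column:
  fixes A :: "'a::comm_ring_1^'n^'n"
  shows "det (\<chi> i j. if j = k then (A *v x)$i else A$i$j) = x$k * det A"
proof -
  have eq: "(\<chi> j. if j = k then column l A else column j A) = transpose (\<chi> i j. if j = k then A$i$l else A$i$j)" for l
    by (simp add: vec_eq_iff transpose_def column_def)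
  have zero: "det (\<chi> j. if j = k then column l A else column j A) = 0" if "l \<noteq> k" for l
    by (rule det_identical_rows[of l k]) (use that in \<open>auto simp: row_def vec_eq_iff\<close>)
  have "(\<chi> i j. if j = k then (A *v x)$i else A$i$j) =
        transpose (\<chi> j. if j = k then (\<Sum>l\<in>UNIV. x$l *s column l A) else column j A)"
    by (simp add: vec_eq_iff transpose_def column_def matrix_vector_mult_def mult.commute)
  then have "det (\<chi> i j. if j = k then (A *v x)$i else A$i$j) =
        (\<Sum>l\<in>UNIV. det (\<chi> j. if j = k then x$l *s column l A else column j A))"
    by (simp only: det_transpose det_linear_row_sum[OF finite])
  also have "\<dots> = (\<Sum>l\<in>UNIV. x$l * det (\<chi> j. if j = k then column l A else column j A))"
    by (simp only: det_row_mul)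
  also have "\<dots> = (\<Sum>l\<in>UNIV. if l = k then x$k * det A else 0)"
  proof (rule sum.cong)
    fix l
    have "(\<chi> j. if j = k then column k A else column j A) = transpose A"
      by (simp add: vec_eq_iff transpose_def column_def)
    then have "det (\<chi> j. if j = k then column k A else column j A) = det A"
      by (simp only: det_transpose)
    then show "x$l * det (\<chi> j. if j = k then column l A else column j A) = (if l = k then x$k * det A else 0)"
      using zero[of l] by auto
  qed simp
  finally show ?thesis by simp
qed

text \<open>If no such \<open>x\<close> existed, a minor not divisible by \<open>p\<close> could be
  enlarged one row and column at a time until it is maximal. Any nonunit \<open>p\<close> is
  allowed: a prime serves the lattice induction, and 0 serves to find a nonzero maximal
  minor.\<close>

lemma exists_kernel_vector_mod:
  fixes B :: "int^'m^'n"
  assumes p: "\<not> p dvd 1"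
    and minors: "\<And>f::'m \<Rightarrow> 'n. p dvd det (\<chi> i k. B$(f i)$k)"
  shows "\<exists>x i. \<not> p dvd x$i \<and> (\<forall>r. p dvd (B *v x)$r)"
proof (rule ccontr)
  assume no: "\<not> ?thesis"
  \<comment> \<open>\<open>det (M f S)\<close> is the minor of \<open>B\<close> with rows
    \<open>f i\<close> for \<open>i \<in> S\<close> and columns \<open>S\<close>: it is 1 for the
    empty set and a maximal minor for \<open>UNIV\<close>.\<close>
  define M where "M f S = (\<chi> i. if i \<in> S then B$(f i) else axis i 1)" for f :: "'m \<Rightarrow> 'n" and S
  have "\<exists>f. \<not> p dvd det (M f S)" for S
  proof (induction S rule: finite_induct[OF finite])
    case 1
    have "M f {} = mat 1" for f
      by (auto simp: M_def mat_def axis_def vec_eq_iff)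
    then show ?case using p by simp
  next
    case (2 s S)
    then obtain f where f: "\<not> p dvd det (M f S)" by blast
    \<comment> \<open>the cofactors of the new row form a kernel vector unless some extension of the minor survives\<close>
    define x where "x = (\<chi> k. det (\<chi> i. if i = s then axis k 1 else M f S $ i))"
    have "(\<chi> i. if i = s then axis s 1 else M f S $ i) = M f S"
      using 2 by (auto simp: M_def vec_eq_iff)
    then have "x$s = det (M f S)" by (simp add: x_def)
    with f no obtain r where r: "\<not> p dvd (B *v x)$r" by metis
    \<comment> \<open>Expanding row \<open>B$r\<close> in unit vectors identifies
      \<open>(B *v x)$r\<close> with the minor enlarged by row \<open>r\<close> and column
      \<open>s\<close>.\<close>
    have "M (f(s := r)) (insert s S) = (\<chi> i. if i = s then (\<Sum>k\<in>UNIV. B$r$k *s axis k 1) else M f S $ i)"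
      using 2 unfolding basis_expansion by (simp add: M_def vec_eq_iff)
    then have "det (M (f(s := r)) (insert s S)) = (\<Sum>k\<in>UNIV. B$r$k * x$k)"
      by (simp only: det_linear_row_sum[OF finite] det_row_mul) (simp add: x_def)
    with r show ?case
      by (intro exI[of _ "f(s := r)"]) (simp only: matrix_vector_mult_def vec_lambda_beta not_False_eq_True)
  qed
  then obtain f where "\<not> p dvd det (M f UNIV)" by blast
  moreover have "M f UNIV = (\<chi> i k. B$(f i)$k)" by (simp add: M_def vec_eq_iff)
  ultimately show False using minors by metis
qed

text \<open>One prime \<open>p\<close> is split off at a time: the lattice of \<open>B'\<close>
  contains that of \<open>B\<close> with index \<open>p\<close>, so each class modulo
  \<open>B'\<close> splits into \<open>p\<close> classes modulo \<open>B\<close>, and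
  \<open>N'\<close> incongruent vectors yield \<open>p * N'\<close>.\<close>

lemma incongruent_kernel_vectors:
  fixes A :: "int^'n^'d" and B :: "int^'m^'n"
  assumes "N > 0"
    and "\<And>f::'m \<Rightarrow> 'n. int N dvd det (\<chi> i k. B$(f i)$k)"
    and "\<And>z. B *v z = 0 \<Longrightarrow> z = 0"
    and "A ** B = 0"
  shows "\<exists>R \<subseteq> kerZ A. finite R \<and> card R = N \<and> (\<forall>r\<in>R. \<forall>r'\<in>R. \<forall>z. r - r' = B *v z \<longrightarrow> r = r')"
  using assms
proof (induction N arbitrary: B rule: less_induct)
  case (less N)
  show ?case
  proof (cases "N = 1")
    case True
    then show ?thesis
      by (intro exI[of _ "{0}"]) (simp add: kerZ_def)
  next
    case False
    then obtain p where p: "prime p" "p dvd N" by (metis prime_factor_nat)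
    then obtain N' where N: "N = p * N'" by auto
    have p1: "p > 1" and p0: "p > 0" using prime_gt_1_nat[OF p(1)] by auto
    have "\<exists>x i. \<not> int p dvd x$i \<and> (\<forall>r. int p dvd (B *v x)$r)"
    proof (rule exists_kernel_vector_mod)
      show "int p dvd det (\<chi> i k. B$(f i)$k)" for f
        using less.prems(2)[of f] N by (metis dvd_mult_left of_nat_mult)
    qed (use p1 in auto)
    then obtain x i where x: "\<not> int p dvd x$i" "\<And>r. int p dvd (B *v x)$r" by blast
    have "coprime (int p) (x$i)"
      using x(1) p(1) by (simp add: prime_imp_coprime)
    then obtain b a where ab: "b * int p + a * x$i = 1"
      by (metis bezout_int coprime_iff_gcd_eq_1)
    \<comment> \<open>By the Bezout relation \<open>y\<close> is congruent to \<open>a\<close> times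
      \<open>x\<close> modulo \<open>p\<close>. Its entry 1 at \<open>i\<close> lets
      \<open>B *v y\<close> replace column \<open>i\<close> of \<open>B\<close> without changing the
      lattice; dividing that column by \<open>p\<close> then gives \<open>B'\<close>.\<close>
    define y where "y = (\<chi> k. if k = i then 1 else a * x$k)"
    have expand: "(\<Sum>k\<in>UNIV. h k) = h i + (\<Sum>k\<in>-{i}. h k)" for h :: "'m \<Rightarrow> int"
      by (metis Compl_eq_Diff_UNIV UNIV_I finite sum.remove)
    have By: "int p dvd (B *v y)$r" for r
    proof -
      have "(B *v y)$r = a * (B *v x)$r + B$r$i * (1 - a * x$i)"
        by (simp add: matrix_vector_mult_def expand y_def algebra_simps sum_distrib_left)
      also have "\<dots> = a * (B *v x)$r + int p * (B$r$i * b)"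
        using ab by (metis add_diff_cancel_right' mult.assoc mult.commute)
      finally show ?thesis using x(2)[of r] by simp
    qed
    define B' where "B' = (\<chi> r k. if k = i then (B *v y)$r div int p else B$r$k)"
    have B'i: "int p * B'$r$i = (B *v y)$r" for r
      using By[of r] by (simp add: B'_def)
    have B'k: "B'$r$k = B$r$k" if "k \<noteq> i" for r k
      using that by (simp add: B'_def)
    have B'v: "(B' *v z)$r = B'$r$i * z$i + (\<Sum>k\<in>-{i}. B$r$k * z$k)" for z r
      by (simp add: matrix_vector_mult_def expand B'k)
    have Bv: "(B *v z)$r = B$r$i * z$i + (\<Sum>k\<in>-{i}. B$r$k * z$k)" for z r
      by (simp add: matrix_vector_mult_def expand)
    have yi: "y$i = 1" by (simp add: y_def)
    \<comment> \<open>\<open>pB'\<close> puts \<open>p\<close> times the lattice of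
      \<open>B'\<close> inside that of \<open>B\<close>; \<open>BB'\<close> puts the lattice of
      \<open>B\<close> inside that of \<open>B'\<close>, with coordinate \<open>i\<close> divisible
      by \<open>p\<close>.\<close>
    have pB': "int p *s (B' *v z) = B *v (\<chi> k. if k = i then z$i else z$i * y$k + int p * z$k)" for z
    proof (subst vec_eq_iff, intro allI)
      fix r
      have "(int p *s (B' *v z))$r = (B *v y)$r * z$i + int p * (\<Sum>k\<in>-{i}. B$r$k * z$k)"
        by (simp add: B'v distrib_left flip: B'i)
      then show "(int p *s (B' *v z))$r = (B *v (\<chi> k. if k = i then z$i else z$i * y$k + int p * z$k))$r"
        by (simp add: Bv yi sum_distrib_left sum_distrib_right sum.distrib algebra_simps)
    qed
    have BB': "B *v z = B' *v (\<chi> k. if k = i then int p * z$i else z$k - z$i * y$k)" for z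
    proof (subst vec_eq_iff, intro allI)
      fix r
      have "(B' *v (\<chi> k. if k = i then int p * z$i else z$k - z$i * y$k))$r =
          (B *v y)$r * z$i + (\<Sum>k\<in>-{i}. B$r$k * (z$k - z$i * y$k))"
        by (simp add: B'v flip: B'i)
      then show "(B *v z)$r = (B' *v (\<chi> k. if k = i then int p * z$i else z$k - z$i * y$k))$r"
        by (simp add: Bv yi sum_distrib_left sum_distrib_right sum_subtractf algebra_simps)
    qed
    have inj: "z = 0" if "B' *v z = 0" for z
    proof -
      have "B *v (\<chi> k. if k = i then z$i else z$i * y$k + int p * z$k) = 0"
        using that by (simp flip: pB')
      then have "(\<chi> k. if k = i then z$i else z$i * y$k + int p * z$k) = 0"
        by (rule less.prems(3))
      then have *: "(if k = i then z$i else z$i * y$k + int p * z$k) = 0" for k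
        unfolding vec_eq_iff by (simp only: vec_lambda_beta zero_index)
      from *[of i] have "z$i = 0" by simp
      then have "z$k = 0" for k
        using *[of k] p0 by (cases "k = i") auto
      then show ?thesis by (simp add: vec_eq_iff)
    qed
    have "\<exists>R \<subseteq> kerZ A. finite R \<and> card R = N' \<and> (\<forall>r\<in>R. \<forall>r'\<in>R. \<forall>z. r - r' = B' *v z \<longrightarrow> r = r')"
    proof (rule less.IH)
      show "N' < N" "N' > 0" using N less.prems(1) p1 by auto
      show "int N' dvd det (\<chi> j k. B'$(f j)$k)" for f
      proof -
        \<comment> \<open>\<open>det_replace_column\<close> enters twice: with
          \<open>axis i (int p)\<close> it moves the factor \<open>p\<close> into column
          \<open>i\<close>, and with \<open>y\<close>, where \<open>y$i = 1\<close>, it recognizes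
          the result as a minor of \<open>B\<close>.\<close>
        have "int p * det (\<chi> j k. B'$(f j)$k) = det (\<chi> j k. if k = i then int p * B'$(f j)$i else B'$(f j)$k)"
          using det_replace_column[of i "\<chi> j k. B'$(f j)$k" "axis i (int p)"]
          by (simp add: matrix_vector_mult_def axis_def if_distrib mult.commute cong: if_cong)
        also have "(\<chi> j k. if k = i then int p * B'$(f j)$i else B'$(f j)$k) =
            (\<chi> j k. if k = i then ((\<chi> j k. B$(f j)$k) *v y)$j else (\<chi> j k. B$(f j)$k)$j$k)"
          by (simp add: vec_eq_iff B'i B'k) (simp add: matrix_vector_mult_def)
        finally have "int p * det (\<chi> j k. B'$(f j)$k) = det (\<chi> j k. B$(f j)$k)"
          by (simp only: det_replace_column yi mult_1)
        then have "int p * int N' dvd int p * det (\<chi> j k. B'$(f j)$k)"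
          using less.prems(2)[of f] N by (simp only: of_nat_mult)
        then show ?thesis using p0 by simp
      qed
      show "A ** B' = 0"
      proof (subst vec_eq_iff, subst vec_eq_iff, intro allI)
        fix q k
        have "(A ** B')$q$k = 0" if "k \<noteq> i"
          using less.prems(4) that by (simp add: matrix_matrix_mult_def vec_eq_iff B'k)
        moreover have "int p * (A ** B')$q$i = (A *v (B *v y))$q"
          by (simp add: matrix_matrix_mult_def matrix_vector_mult_def[of A] sum_distrib_left mult.left_commute flip: B'i)
        then have "int p * (A ** B')$q$i = 0"
          using less.prems(4) by (simp add: matrix_vector_mul_assoc)
        then have "(A ** B')$q$i = 0" using p0 by simp
        ultimately show "(A ** B')$q$k = 0$q$k" by (cases "k = i") auto
      qed
    qed (rule inj)
    then obtain R where R: "R \<subseteq> kerZ A" "finite R" "card R = N'"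
      "\<And>r r' z. r \<in> R \<Longrightarrow> r' \<in> R \<Longrightarrow> r - r' = B' *v z \<Longrightarrow> r = r'" by blast
    have AB': "A *v (B' *v z) = 0" for z
    proof -
      have "int p *s (A *v (B' *v z)) = A *v (int p *s (B' *v z))"
        by (simp add: matrix_vector_mult_def vec_eq_iff sum_distrib_left mult.left_commute)
      also have "\<dots> = 0"
        by (simp add: pB' matrix_vector_mul_assoc less.prems(4))
      finally show ?thesis using p0 by (simp add: vec_eq_iff)
    qed
    \<comment> \<open>The multiples \<open>B' *v axis i (int t)\<close> with \<open>t < p\<close>
      represent the classes of the lattice of \<open>B'\<close> modulo that of
      \<open>B\<close>.\<close>
    define F where "F = (\<lambda>(r, t). r + B' *v axis i (int t))"
    have key: "r = r' \<and> t = t'"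
      if "r \<in> R" "r' \<in> R" "t < p" "t' < p" and eq: "F (r, t) - F (r', t') = B *v z" for r r' t t' z
    proof -
      let ?z = "\<chi> k. if k = i then int p * z$i else z$k - z$i * y$k"
      have "r - r' = B' *v ?z - B' *v axis i (int t) + B' *v axis i (int t')"
        using eq BB'[of z] by (simp add: F_def algebra_simps)
      \<comment> \<open>Congruence modulo \<open>B'\<close> identifies \<open>r\<close> with
        \<open>r'\<close>; injectivity then leaves coordinate \<open>i\<close>, where
        \<open>t\<close> and \<open>t'\<close> must agree modulo \<open>p\<close>.\<close>
      then have *: "r - r' = B' *v (?z - axis i (int t) + axis i (int t'))"
        by (simp add: matrix_vector_mult_diff_distrib matrix_vector_right_distrib)
      then have r: "r = r'" using R(4) that by blast
      then have "?z - axis i (int t) + axis i (int t') = 0"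
        using * by (intro inj) simp
      then have "(?z - axis i (int t) + axis i (int t'))$i = 0" by simp
      then have "int p * z$i = int t - int t'" by (simp add: axis_def)
      then have "int p dvd int t - int t'" by (metis dvd_triv_left)
      then have "int t mod int p = int t' mod int p" by (simp add: mod_eq_dvd_iff)
      then have "t = t'" using that by simp
      with r show ?thesis by simp
    qed
    have "inj_on F (R \<times> {..<p})"
    proof (rule inj_onI)
      fix q q' assume q: "q \<in> R \<times> {..<p}" "q' \<in> R \<times> {..<p}" "F q = F q'"
      then have "F (fst q, snd q) - F (fst q', snd q') = B *v 0" by simp
      with key q(1,2) show "q = q'"
        by (metis lessThan_iff mem_Times_iff prod_eqI)
    qed
    then have "card (F ` (R \<times> {..<p})) = N"
      using R by (simp add: card_image N)
    moreover have "F ` (R \<times> {..<p}) \<subseteq> kerZ A"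
      using R(1) by (auto simp: F_def kerZ_def AB' matrix_vector_right_distrib)
    moreover have "q = q'" if "q \<in> F ` (R \<times> {..<p})" "q' \<in> F ` (R \<times> {..<p})" "q - q' = B *v z" for q q' z
    proof -
      from that(1,2) obtain r t r' t' where "r \<in> R" "t < p" "r' \<in> R" "t' < p" "q = F (r, t)" "q' = F (r', t')"
        by blast
      with key that(3) show ?thesis by metis
    qed
    ultimately show ?thesis
      using R(2) by (intro exI[of _ "F ` (R \<times> {..<p})"]) simp
  qed
qed

text \<open>Numbering the incongruent vectors gives a function constant on cosets of the lattice of
  \<open>B\<close> that takes every label on \<open>kerZ A\<close>. Sorting exponents by it cuts a
  series into exactly \<open>N\<close> parts, each supported on a union of cosets.\<close>

lemma coset_labelling:
  fixes A :: "int^'n^'d" and B :: "int^'m^'n"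
  assumes "N > 0"
    and "\<And>f::'m \<Rightarrow> 'n. int N dvd det (\<chi> i k. B$(f i)$k)"
    and "\<And>z. B *v z = 0 \<Longrightarrow> z = 0"
    and "A ** B = 0"
  obtains h :: "int^'n \<Rightarrow> nat" where
    "\<And>u. h u \<in> {1..N}" "\<And>u z. h (u + B *v z) = h u" "\<And>l. l \<in> {1..N} \<Longrightarrow> \<exists>q\<in>kerZ A. h q = l"
proof -
  obtain R where R: "R \<subseteq> kerZ A" "finite R" "card R = N"
    "\<And>r r' z. r \<in> R \<Longrightarrow> r' \<in> R \<Longrightarrow> r - r' = B *v z \<Longrightarrow> r = r'"
    using incongruent_kernel_vectors[OF assms] by blast
  obtain e where e: "bij_betw e {1..N} R"
    using ex_bij_betw_nat_finite_1[OF R(2)] R(3) by auto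
  define P where "P u l \<longleftrightarrow> l \<in> {1..N} \<and> (\<exists>z. u = e l + B *v z)" for u l
  \<comment> \<open>cosets not represented in \<open>R\<close> receive the label 1\<close>
  define h where "h u = (if \<exists>l. P u l then SOME l. P u l else 1)" for u
  have shift: "P (u + B *v z) l" if "P u l" for u z l
    using that unfolding P_def by (metis add.assoc matrix_vector_right_distrib)
  have "P (u + B *v z) l \<longleftrightarrow> P u l" for u z l
    using shift[of "u + B *v z" l "- z"] shift[of u l z]
    by (auto simp: add.assoc simp flip: matrix_vector_right_distrib)
  then have "P (u + B *v z) = P u" for u z by blast
  then have "h (u + B *v z) = h u" for u z by (simp add: h_def)
  moreover have "h u \<in> {1..N}" for u
  proof (cases "\<exists>l. P u l")
    case True
    then have "P u (h u)" unfolding h_def by (simp add: someI_ex)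
    then show ?thesis by (simp add: P_def)
  next
    case False
    then show ?thesis using assms(1) by (simp add: h_def)
  qed
  moreover have "\<exists>q\<in>kerZ A. h q = l" if l: "l \<in> {1..N}" for l
  proof
    show "e l \<in> kerZ A" using e l R(1) by (metis bij_betwE subsetD)
    have P: "P (e l) l" using l unfolding P_def by (metis add.right_neutral matrix_vector_mult_0_right)
    \<comment> \<open>The label chosen for \<open>e l\<close> could a priori differ from
      \<open>l\<close>; incongruence within \<open>R\<close> rules this out.\<close>
    then have "P (e l) (h (e l))" unfolding h_def by (metis someI_ex)
    then obtain z where "h (e l) \<in> {1..N}" "e l - e (h (e l)) = B *v z"
      unfolding P_def by (metis add_diff_cancel_left')
    then have "e l = e (h (e l))" using R(4) e l by (meson bij_betwE)
    then show "h (e l) = l" using e l \<open>h (e l) \<in> {1..N}\<close> by (metis bij_betw_inv_into_left)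
  qed
  ultimately show thesis using that by blast
qed

section \<open>Formal solutions of A-hypergeometric systems\<close>

lemma of_int_eq_nat_diff: "of_int a = of_nat (nat a) - (of_nat (nat (- a)) :: 'a::ring_1)"
  by (cases "a \<ge> 0") auto

text \<open>Compare the coefficients of the binomial equation for \<open>u\<close> at
  \<open>v = w - u_-\<close>, where the right side involves \<open>f w\<close>. Its falling
  factorials vanish only if some \<open>w$j\<close> is a natural number below \<open>- u$j\<close>,
  which \<open>pos\<close> excludes; so the left side, a multiple of \<open>f (w + u)\<close>, is
  nonzero.\<close>

lemma A_hyp_sol_support:
  assumes f: "is_A_hyp_sol A \<beta> f" "f w \<noteq> 0" and u: "u \<in> kerZ A"
    and pos: "\<And>j. w$j \<in> \<int> \<Longrightarrow> 0 \<le> u$j"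
  shows "f (w + int_to_cvec u) \<noteq> 0"
proof -
  define v where "v = w - (\<chi> j. of_nat (neg_part u $ j))"
  have w: "v + (\<chi> j. of_nat (neg_part u $ j)) = w" by (simp add: v_def)
  have wu: "v + (\<chi> j. of_nat (pos_part u $ j)) = w + int_to_cvec u"
    by (simp add: v_def vec_eq_iff pos_part_def neg_part_def int_to_cvec_def of_int_eq_nat_diff[of "u$j" for j])
  have vj: "v$j + of_nat (neg_part u $ j) = w$j" for j
    by (simp add: v_def)
  have "ffact (w$j) (neg_part u $ j) \<noteq> 0" for j
  proof
    assume "ffact (w$j) (neg_part u $ j) = 0"
    then obtain i where i: "i < neg_part u $ j" "w$j = of_nat i"
      by (auto simp: ffact_def)
    then have "w$j \<in> \<int>" by simp
    with pos i(1) show False by (simp add: neg_part_def)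
  qed
  then have "dmon (neg_part u) f v \<noteq> 0"
    using f(2) by (simp add: dmon_def w vj)
  then have "dmon (pos_part u) f v \<noteq> 0"
    using f(1) u by (simp add: is_A_hyp_sol_def)
  then show ?thesis by (auto simp: dmon_def wu)
qed

lemma int_to_cvec_mult: "int_to_cvec (B *v z) = mat_cvec B (int_to_cvec z)"
  by (simp add: vec_eq_iff int_to_cvec_def mat_cvec_def matrix_vector_mult_def)

lemma int_to_cvec_add: "int_to_cvec (u + v) = int_to_cvec u + int_to_cvec v"
  and int_to_cvec_diff: "int_to_cvec (u - v) = int_to_cvec u - int_to_cvec v"
  by (simp_all add: vec_eq_iff int_to_cvec_def)

lemma mat_cvec_add: "mat_cvec B (v + w) = mat_cvec B v + mat_cvec B w"
  and mat_cvec_diff: "mat_cvec B (v - w) = mat_cvec B v - mat_cvec B w"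
  by (simp_all add: vec_eq_iff mat_cvec_def algebra_simps sum.distrib sum_subtractf)

text \<open>Column \<open>i\<close> of \<open>B\<close> lies in \<open>kerZ A\<close>, and
  \<open>hornL\<close> is a coordinate of \<open>c + mat_cvec B v\<close>. The falling factorials of
  the binomial equation are therefore those of the Horn operator.\<close>

lemma A_hyp_sol_horn:
  fixes B :: "int^'m^'n"
  assumes f: "is_A_hyp_sol A \<beta> f" and AB: "A ** B = 0"
  shows "hornQ B c i v * f (c + mat_cvec B v) =
    hornP B c i (v - axis i 1) * f (c + mat_cvec B (v - axis i 1))"
proof -
  define u where "u = column i B"
  have "u = B *v axis i 1"
    by (simp add: u_def column_def vec_eq_iff matrix_vector_mult_def axis_def if_distrib cong: if_cong)
  then have u: "u \<in> kerZ A"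
    by (simp add: kerZ_def matrix_vector_mul_assoc AB)
  \<comment> \<open>At this exponent the two sides of the binomial equation read \<open>f\<close> at
    \<open>c + B v\<close> and at \<open>c + B (v - e_i)\<close>.\<close>
  define x where "x = c + mat_cvec B v - (\<chi> j. of_nat (pos_part u $ j))"
  have xp: "x + (\<chi> j. of_nat (pos_part u $ j)) = c + mat_cvec B v"
    by (simp add: x_def)
  have e: "mat_cvec B (axis i 1) = int_to_cvec u"
    by (simp add: u_def column_def vec_eq_iff mat_cvec_def int_to_cvec_def axis_def if_distrib cong: if_cong)
  have xn: "x + (\<chi> j. of_nat (neg_part u $ j)) = c + mat_cvec B (v - axis i 1)"
    by (simp add: x_def vec_eq_iff pos_part_def neg_part_def int_to_cvec_def mat_cvec_diff e
          of_int_eq_nat_diff[of "u$j" for j])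
  have L: "hornL B c j v = (c + mat_cvec B v)$j" for j v
    by (simp add: hornL_def mat_cvec_def)
  have "hornQ B c i v = (\<Prod>j\<in>UNIV. ffact (x$j + of_nat (pos_part u $ j)) (pos_part u $ j))"
    unfolding hornQ_def
  \<comment> \<open>Rows whose entry does not have the required sign contribute an empty falling
    factorial, so the product extends to all rows.\<close>
  proof (rule prod.mono_neutral_cong_left)
    show "ffact (hornL B c j v) (nat (B$j$i)) = ffact (x$j + of_nat (pos_part u $ j)) (pos_part u $ j)" for j
      unfolding L xp[symmetric] by (simp add: pos_part_def u_def column_def)
  qed (auto simp: pos_part_def u_def column_def ffact_def)
  moreover have "hornP B c i (v - axis i 1) = (\<Prod>j\<in>UNIV. ffact (x$j + of_nat (neg_part u $ j)) (neg_part u $ j))"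
    unfolding hornP_def
  proof (rule prod.mono_neutral_cong_left)
    show "ffact (hornL B c j (v - axis i 1)) (nat (- B$j$i)) = ffact (x$j + of_nat (neg_part u $ j)) (neg_part u $ j)" for j
      unfolding L xn[symmetric] by (simp add: neg_part_def u_def column_def)
  qed (auto simp: neg_part_def u_def column_def ffact_def)
  moreover have "dmon (pos_part u) f x = dmon (neg_part u) f x"
    using f u by (simp add: is_A_hyp_sol_def)
  ultimately show ?thesis
    by (simp add: dmon_def xp xn mult.commute)
qed

section \<open>Generic parameters and full support\<close>

text \<open>Linear independence of the rows in \<open>J\<close> makes \<open>B\<close>, followed by
  projection to the coordinates in \<open>J\<close>, surjective; the all-ones vector on
  \<open>J\<close> is then attained.\<close>

lemma exists_dual_vector:
  fixes B :: "real^'m^'n"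
  assumes indep: "\<And>\<mu>::real^'n. (\<forall>j. j \<notin> J \<longrightarrow> \<mu>$j = 0) \<Longrightarrow> (\<forall>k. (\<Sum>j\<in>UNIV. \<mu>$j * B$j$k) = 0) \<Longrightarrow> \<mu> = 0"
  shows "\<exists>d. \<forall>j\<in>J. (B *v d)$j = 1"
proof -
  define \<pi> where "\<pi> y = (\<chi> j. if j \<in> J then y$j else 0)" for y :: "real^'n"
  have lin: "linear (\<lambda>x. \<pi> (B *v x))"
    by (rule linearI) (auto simp: \<pi>_def vec_eq_iff matrix_vector_right_distrib matrix_vector_mult_scaleR)
  define V where "V = range (\<lambda>x. \<pi> (B *v x))"
  have V: "subspace V" unfolding V_def by (intro linear_subspace_image lin subspace_UNIV)
  obtain p q where p: "p \<in> V" and q: "\<And>w. w \<in> V \<Longrightarrow> orthogonal q w" and pq: "\<pi> 1 = p + q"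
    using orthogonal_subspace_decomp_exists[of V "\<pi> 1"] V by (metis span_eq_iff)
  \<comment> \<open>Orthogonality of \<open>q\<close> to the images of the unit vectors says that
    its \<open>J\<close>-part is a linear relation between the rows of \<open>B\<close>.\<close>
  have "\<pi> q = 0"
  proof (rule indep)
    show "\<forall>k. (\<Sum>j\<in>UNIV. \<pi> q$j * B$j$k) = 0"
    proof
      fix k
      have "orthogonal q (\<pi> (B *v axis k 1))" using q by (simp add: V_def)
      then show "(\<Sum>j\<in>UNIV. \<pi> q$j * B$j$k) = 0"
        by (simp add: orthogonal_def inner_vec_def \<pi>_def matrix_vector_mult_def axis_def if_distrib
              if_distribR cong: if_cong)
    qed
  qed (simp add: \<pi>_def)
  moreover obtain d where d: "p = \<pi> (B *v d)" using p by (auto simp: V_def)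
  ultimately have "(B *v d)$j = 1" if "j \<in> J" for j
  proof -
    have "\<pi> 1 $ j = p$j + q$j" "q$j = \<pi> q $ j" using that pq by (auto simp: \<pi>_def)
    with \<open>\<pi> q = 0\<close> d that show ?thesis by (simp add: \<pi>_def)
  qed
  then show ?thesis by blast
qed

text \<open>If the coordinates of \<open>c + B v\<close> in \<open>J\<close> are integers
  \<open>z\<close> and the rows in \<open>J\<close> satisfy a relation \<mu>, then pairing with
  \<mu> removes \<open>B v\<close> and puts \<open>c\<close> on one of countably many real
  hyperplanes. Off these, the rows with integer coordinates are independent and a dual vector
  exists.\<close>

lemma generic_parameters:
  fixes B :: "int^'m^'n"
  obtains E :: "(complex^'n) set" where "E \<in> null_sets lborel"
    "\<And>c v. c \<notin> E \<Longrightarrow> \<exists>d. \<forall>j. (c + mat_cvec B v)$j \<in> \<int> \<longrightarrow> ((\<chi> j k. real_of_int (B$j$k)) *v d)$j = 1"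
proof -
  define rel where "rel J \<mu> \<longleftrightarrow> \<mu> \<noteq> 0 \<and> (\<forall>j. j \<notin> J \<longrightarrow> \<mu>$j = 0) \<and>
    (\<forall>k. (\<Sum>j\<in>UNIV. \<mu>$j * real_of_int (B$j$k)) = 0)" for J and \<mu> :: "real^'n"
  \<comment> \<open>One relation is fixed for each dependent \<open>J\<close>, which keeps the union
    \<open>E\<close> countable.\<close>
  define M where "M J = (SOME \<mu>. rel J \<mu>)" for J
  define cx where "cx \<mu> = (\<chi> j. complex_of_real (\<mu>$j))" for \<mu> :: "real^'n"
  \<comment> \<open>The inner product on complex vectors is the real one, so the left side is the
    sum of \<open>M J$j * Re (c$j)\<close>.\<close>
  define E where "E = (\<Union>J\<in>{J. \<exists>\<mu>. rel J \<mu>}. \<Union>z::int^'n. {c. cx (M J) \<bullet> c = (\<Sum>j\<in>UNIV. M J$j * of_int (z$j))})"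
  have "E \<in> null_sets lborel"
    unfolding E_def
  proof (intro null_sets_UN')
    show "countable {J. \<exists>\<mu>. rel J \<mu>}" "countable (UNIV :: (int^'n) set)"
      by (simp_all add: countable_finite)
    fix J and z :: "int^'n" assume "J \<in> {J. \<exists>\<mu>. rel J \<mu>}"
    then have "\<exists>\<mu>. rel J \<mu>" by simp
    then have "rel J (M J)" unfolding M_def by (rule someI_ex)
    then have "cx (M J) \<noteq> 0" by (auto simp: rel_def cx_def vec_eq_iff)
    then have "negligible {c. cx (M J) \<bullet> c = (\<Sum>j\<in>UNIV. M J$j * of_int (z$j))}"
      by (intro negligible_hyperplane) simp
    moreover have "closed {c. cx (M J) \<bullet> c = (\<Sum>j\<in>UNIV. M J$j * of_int (z$j))}"
      by (rule closed_hyperplane)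
    ultimately show "{c. cx (M J) \<bullet> c = (\<Sum>j\<in>UNIV. M J$j * of_int (z$j))} \<in> null_sets lborel"
      by (metis borel_closed negligible_iff_null_sets null_sets_completion_iff sets_lborel)
  qed
  moreover have "\<exists>d. \<forall>j. (c + mat_cvec B v)$j \<in> \<int> \<longrightarrow> ((\<chi> j k. real_of_int (B$j$k)) *v d)$j = 1"
    if "c \<notin> E" for c v
  proof -
    define J where "J = {j. (c + mat_cvec B v)$j \<in> \<int>}"
    have "\<not> rel J \<mu>" for \<mu>
    proof
      assume "rel J \<mu>"
      then have ex: "\<exists>\<mu>. rel J \<mu>" by blast
      then have rel: "rel J (M J)" unfolding M_def by (rule someI_ex)
      \<comment> \<open>The floor returns the integer itself for \<open>j \<in> J\<close>; elsewhere
        its value is harmless because \<open>M J\<close> vanishes there.\<close>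
      define z where "z = (\<chi> j. \<lfloor>Re ((c + mat_cvec B v)$j)\<rfloor>)"
      have z: "M J$j * of_int (z$j) = M J$j * Re ((c + mat_cvec B v)$j)" for j
      proof (cases "j \<in> J")
        case True
        then obtain n where "(c + mat_cvec B v)$j = of_int n"
          unfolding J_def by (auto elim: Ints_cases)
        then show ?thesis by (simp only: z_def vec_lambda_beta complex_Re_of_int floor_of_int)
      next
        case False
        then show ?thesis using rel by (simp add: rel_def)
      qed
      have "(\<Sum>j\<in>UNIV. M J$j * Re (mat_cvec B v$j)) = (\<Sum>j\<in>UNIV. \<Sum>k\<in>UNIV. M J$j * of_int (B$j$k) * Re (v$k))"
        by (simp add: mat_cvec_def sum_distrib_left mult.assoc)
      also have "\<dots> = (\<Sum>k\<in>UNIV. (\<Sum>j\<in>UNIV. M J$j * of_int (B$j$k)) * Re (v$k))"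
        by (subst sum.swap) (simp add: sum_distrib_right)
      also have "\<dots> = 0" using rel by (simp add: rel_def)
      finally have "cx (M J) \<bullet> c = (\<Sum>j\<in>UNIV. M J$j * of_int (z$j))"
        by (simp add: z cx_def inner_vec_def inner_complex_def distrib_left sum.distrib)
      with that ex show False by (auto simp: E_def)
    qed
    then have "\<exists>d. \<forall>j\<in>J. ((\<chi> j k. real_of_int (B$j$k)) *v d)$j = 1"
      by (intro exists_dual_vector) (auto simp: rel_def)
    then show ?thesis by (simp add: J_def)
  qed
  ultimately show thesis using that by blast
qed

text \<open>The cone \<open>b_j \<bullet> x \<ge> 0\<close> for \<open>j \<in> J\<close> has
  \<open>d\<close> in its interior. Shifted far enough along \<open>d\<close>, each of its points
  lies in a unit cube whose vertices all satisfy the bounds \<open>N j\<close>, hence in the convex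
  hull of the support.\<close>

lemma fully_supported_if_lattice_cone:
  fixes B :: "int^'m^'n" and d :: "real^'m" and \<psi> :: "complex^'m \<Rightarrow> complex"
  assumes d: "\<And>j. j \<in> J \<Longrightarrow> ((\<chi> j k. real_of_int (B$j$k)) *v d)$j = 1"
    and supp: "\<And>z. (\<And>j. j \<in> J \<Longrightarrow> N j \<le> (B *v z)$j) \<Longrightarrow> \<psi> (p + int_to_cvec z) \<noteq> 0"
  shows "fully_supported \<psi>"
proof -
  define BR where "BR = (\<chi> j k. real_of_int (B$j$k))"
  define cx where "cx w = (\<chi> i. complex_of_real (w$i))" for w :: "real^'m"
  \<comment> \<open>\<open>S j\<close> bounds the change of \<open>(BR *v x)$j\<close> when each
    coordinate moves by at most 1; \<open>M\<close> dominates every \<open>N j + S j\<close>, so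
    rounding costs nothing after a shift by \<open>M *\<^sub>R d\<close>.\<close>
  define S where "S j = (\<Sum>k\<in>UNIV. \<bar>BR$j$k\<bar>)" for j
  define M where "M = (\<Sum>j\<in>UNIV. \<bar>real_of_int (N j)\<bar> + S j)"
  have M: "N j + S j \<le> M" for j
  proof -
    have "\<bar>real_of_int (N j)\<bar> + S j \<le> M"
      unfolding M_def by (rule member_le_sum) (auto simp: S_def sum_nonneg)
    then show ?thesis by linarith
  qed
  define K where "K = {x. \<forall>j\<in>J. 0 \<le> (BR *v x)$j}"
  have "convex K"
    by (rule convexI) (auto simp: K_def matrix_vector_right_distrib matrix_vector_mult_scaleR)
  moreover have "cone K"
    by (auto simp: K_def cone_def matrix_vector_mult_scaleR)
  moreover have "interior K \<noteq> {}"
  proof -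
    have "open {x. \<forall>j\<in>J. 0 < (BR *v x)$j}"
    proof -
      have "open {x. 0 < (BR *v x)$j}" for j
        by (intro open_Collect_less continuous_intros)
      then have "open (\<Inter>j\<in>J. {x. 0 < (BR *v x)$j})" by (intro open_INT) auto
      then show ?thesis by (simp add: Collect_ball_eq)
    qed
    moreover have "{x. \<forall>j\<in>J. 0 < (BR *v x)$j} \<subseteq> K" by (auto simp: K_def less_imp_le)
    moreover have "d \<in> {x. \<forall>j\<in>J. 0 < (BR *v x)$j}" using d by (simp add: BR_def)
    ultimately show ?thesis by (metis empty_iff interior_maximal subsetD)
  qed
  moreover have "(p + cx (M *\<^sub>R d)) + cx x \<in> convex hull (supp \<psi>)" if "x \<in> K" for x
  proof -
    define y where "y = M *\<^sub>R d + x"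
    define f where "f = (\<chi> i. \<lfloor>y$i\<rfloor>)"
    define V where "V = {t::real^'m. \<forall>i. t$i = 0 \<or> t$i = 1}"
    have lin: "linear cx" by (rule linearI) (auto simp: cx_def vec_eq_iff scaleR_conv_of_real[where 'a=complex])
    have "y - (\<chi> i. of_int (f$i)) \<in> cbox 0 1"
      using of_int_floor_le[of "y$i" for i] real_of_int_floor_add_one_ge[of "y$i" for i]
      by (simp add: f_def mem_box_cart algebra_simps)
    moreover have "cbox 0 1 = convex hull V"
    proof -
      have "One = (1 :: real^'m)"
        by (rule Cart_1[symmetric])
      moreover have "{t::real^'m. \<forall>i\<in>Basis. t \<bullet> i = 0 \<or> t \<bullet> i = 1} = V"
        by (simp add: V_def Basis_vec_def inner_axis)
      ultimately show ?thesis using unit_interval_convex_hull[where 'a = "real^'m"] by metis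
    qed
    ultimately have "y - (\<chi> i. of_int (f$i)) \<in> convex hull V" by simp
    then have "cx (y - (\<chi> i. of_int (f$i))) \<in> convex hull (cx ` V)"
      using convex_hull_linear_image[OF lin, of V] by blast
    then have "(p + int_to_cvec f) + cx (y - (\<chi> i. of_int (f$i))) \<in> convex hull ((+) (p + int_to_cvec f) ` cx ` V)"
      by (subst convex_hull_translation) blast
    moreover have "(+) (p + int_to_cvec f) ` cx ` V \<subseteq> supp \<psi>"
    proof clarify
      fix t assume t: "t \<in> V"
      \<comment> \<open>The entries of \<open>t\<close> are 0 or 1, so the floor only turns the
        vertex into an integer vector.\<close>
      define z where "z = (\<chi> i. f$i + \<lfloor>t$i\<rfloor>)"
      have zi: "real_of_int (z$i) = of_int (f$i) + t$i" for i
        using t by (auto simp: V_def z_def) (metis floor_of_int of_int_0 of_int_1)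
      have "int_to_cvec z = int_to_cvec f + cx t"
        using zi by (simp add: vec_eq_iff int_to_cvec_def cx_def) (metis of_real_add of_real_of_int_eq)
      moreover have "\<psi> (p + int_to_cvec z) \<noteq> 0"
      proof (rule supp)
        fix j assume j: "j \<in> J"
        have dist: "\<bar>z$i - y$i\<bar> \<le> 1" for i
        proof -
          have "t$i = 0 \<or> t$i = 1" using t by (simp add: V_def)
          moreover have "of_int (f$i) \<le> y$i" "y$i < of_int (f$i) + 1" by (auto simp: f_def)
          ultimately show ?thesis unfolding zi by linarith
        qed
        have "\<bar>(BR *v ((\<chi> i. of_int (z$i)) - y))$j\<bar> \<le> (\<Sum>k\<in>UNIV. \<bar>BR$j$k * (z$k - y$k)\<bar>)"
          unfolding matrix_vector_mult_def by simp
        also have "\<dots> \<le> S j"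
          unfolding S_def abs_mult by (intro sum_mono mult_left_le dist) auto
        finally have "- S j \<le> (BR *v (\<chi> i. of_int (z$i)))$j - (BR *v y)$j"
          by (simp add: matrix_vector_mult_diff_distrib)
        moreover have "M \<le> (BR *v y)$j"
          using that d[OF j] j by (simp add: y_def K_def BR_def matrix_vector_right_distrib matrix_vector_mult_scaleR)
        moreover have "(BR *v (\<chi> i. of_int (z$i)))$j = of_int ((B *v z)$j)"
          by (simp add: BR_def matrix_vector_mult_def)
        ultimately show "N j \<le> (B *v z)$j" using M[of j] by linarith
      qed
      ultimately show "p + int_to_cvec f + cx t \<in> supp \<psi>"
        by (simp add: supp_def add.assoc)
    qed
    ultimately have "(p + int_to_cvec f) + cx (y - (\<chi> i. of_int (f$i))) \<in> convex hull (supp \<psi>)"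
      using hull_mono by blast
    moreover have "(p + int_to_cvec f) + cx (y - (\<chi> i. of_int (f$i))) = (p + cx (M *\<^sub>R d)) + cx x"
      by (simp add: vec_eq_iff cx_def y_def int_to_cvec_def)
    ultimately show ?thesis by simp
  qed
  ultimately show ?thesis
    unfolding fully_supported_def cx_def by blast
qed

text \<open>The convex hull of a finite set is bounded, whereas a cone with interior contains a
  whole ray.\<close>

lemma fully_supported_imp_infinite:
  fixes \<psi> :: "complex^'m \<Rightarrow> complex"
  assumes "fully_supported \<psi>"
  shows "infinite (supp \<psi>)"
proof
  assume "finite (supp \<psi>)"
  then have "bounded (convex hull (supp \<psi>))"
    by (intro bounded_convex_hull finite_imp_bounded)
  moreover obtain p and K :: "(real^'m) set" where K: "cone K" "interior K \<noteq> {}"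
    "(\<lambda>w. p + (\<chi> i. complex_of_real (w$i))) ` K \<subseteq> convex hull (supp \<psi>)"
    using assms unfolding fully_supported_def by blast
  ultimately obtain b where b: "\<And>x. x \<in> K \<Longrightarrow> norm (p + (\<chi> i. complex_of_real (x$i))) \<le> b"
    unfolding bounded_iff by blast
  have "\<not> K \<subseteq> {0}"
    using K(2) interior_mono[of K "{0}"] by auto
  then obtain x where x0: "x \<in> K" "x \<noteq> 0" by blast
  then obtain i where x: "x \<in> K" "x$i \<noteq> 0"
    by (metis vec_eq_iff zero_index)
  \<comment> \<open>This scaling makes coordinate \<open>i\<close> of \<open>t *\<^sub>R x\<close>
    exceed \<open>b + norm (p$i)\<close> in absolute value.\<close>
  define t where "t = (\<bar>b\<bar> + norm (p$i) + 1) / \<bar>x$i\<bar>"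
  have "t *\<^sub>R x \<in> K"
    using K(1) x(1) by (simp add: cone_def t_def)
  then have "norm (p + (\<chi> i. complex_of_real ((t *\<^sub>R x)$i))) \<le> b" by (rule b)
  then have "norm ((p + (\<chi> i. complex_of_real ((t *\<^sub>R x)$i)))$i) \<le> b"
    by (rule order_trans[OF Finite_Cartesian_Product.norm_nth_le])
  then have "norm (complex_of_real (t * x$i)) \<le> b + norm (p$i)"
    using norm_diff_ineq[of "complex_of_real (t * x$i)" "p$i"] by (simp add: add.commute)
  moreover have "norm (complex_of_real (t * x$i)) = \<bar>b\<bar> + norm (p$i) + 1"
    unfolding norm_of_real abs_mult using x(2) by (simp add: t_def)
  ultimately show False by linarith
qed

section \<open>Horn solutions\<close>

text \<open>The range of \<open>B\<close> lies in the orthogonal complement of the row space of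
  \<open>A\<close>, and the rank condition gives both the same dimension.\<close>

lemma real_kernel_eq_range:
  fixes A :: "real^'n^'d" and B :: "real^'m^'n"
  assumes "rank A + rank B = CARD('n)" "A ** B = 0" "A *v x = 0"
  shows "\<exists>y. x = B *v y"
proof -
  define T where "T = {y. \<forall>x\<in>span (rows A). orthogonal x y}"
  have ker: "y \<in> T" if "A *v y = 0" for y
    unfolding T_def using orthogonal_nullspace_rowspace[OF that] by (auto simp: orthogonal_commute)
  have "dim T + dim (rows A) = CARD('n)"
    using dim_subspace_orthogonal_to_vectors[of "span (rows A)" UNIV]
    by (simp add: T_def)
  then have "dim T = dim (range ((*v) B))"
    using assms(1) row_rank_def[of A] rank_dim_range[of B] by linarith
  moreover have "range ((*v) B) \<subseteq> T"
    using ker assms(2) by (auto simp: matrix_vector_mul_assoc)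
  moreover have "subspace (range ((*v) B))"
    by (intro linear_subspace_image matrix_vector_mul_linear subspace_UNIV)
  moreover have "subspace T"
    unfolding T_def using subspace_orthogonal_to_vectors by auto
  ultimately have "range ((*v) B) = T"
    by (intro subspace_dim_equal) auto
  then show ?thesis using ker[OF assms(3)] by blast
qed

lemma int_to_cvec_inject: "int_to_cvec u = int_to_cvec v \<longleftrightarrow> u = v"
  by (simp add: vec_eq_iff int_to_cvec_def)

lemma mat_cvec_kerZ: "u \<in> kerZ A \<Longrightarrow> mat_cvec A (int_to_cvec u) = 0"
  by (simp add: kerZ_def flip: int_to_cvec_mult) (simp add: int_to_cvec_def vec_eq_iff)

lemma kerZ_add: "u \<in> kerZ A \<Longrightarrow> v \<in> kerZ A \<Longrightarrow> u + v \<in> kerZ A"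
  and kerZ_diff: "u \<in> kerZ A \<Longrightarrow> v \<in> kerZ A \<Longrightarrow> u - v \<in> kerZ A"
  by (simp_all add: kerZ_def matrix_vector_right_distrib matrix_vector_mult_diff_distrib)

lemma subst_xB_apply:
  assumes "\<And>v w. mat_cvec B v = mat_cvec B w \<Longrightarrow> v = w"
  shows "subst_xB B c \<psi> (c + mat_cvec B v) = \<psi> v"
proof -
  have "(SOME v'. c + mat_cvec B v = c + mat_cvec B v') = v"
    using assms by (intro some_equality) auto
  then show ?thesis by (auto simp: subst_xB_def)
qed

text \<open>Keep in \<open>\<psi> l\<close> the exponents of \<open>f\<close> whose coset has label
  \<open>l\<close>. The Horn equations only link exponents of one coset, so each part inherits them;
  one nonzero coefficient of \<open>f\<close> propagates to a cone in every label class.\<close>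

lemma horn_decomposition:
  fixes A :: "int^'n^'d" and B :: "int^'m^'n" and f :: "complex^'n \<Rightarrow> complex"
    and h :: "int^'n \<Rightarrow> nat"
  assumes AB: "A ** B = 0"
    and inj: "\<And>v w. mat_cvec B v = mat_cvec B w \<Longrightarrow> v = w"
    and ker: "\<And>w. mat_cvec A w = 0 \<Longrightarrow> \<exists>v. w = mat_cvec B v"
    and h: "\<And>u. h u \<in> {1..N}" "\<And>u z. h (u + B *v z) = h u" "\<And>l. l \<in> {1..N} \<Longrightarrow> \<exists>q\<in>kerZ A. h q = l"
    and generic: "\<And>v. \<exists>d. \<forall>j. (c + mat_cvec B v)$j \<in> \<int> \<longrightarrow> ((\<chi> j k. real_of_int (B$j$k)) *v d)$j = 1"
    and f: "is_A_hyp_sol A (mat_cvec A c) f" "supp f \<subseteq> {\<alpha> + int_to_cvec u | u. u \<in> kerZ A}" "f w0 \<noteq> 0"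
  shows "\<exists>\<psi>. (\<forall>l\<in>{1..N}. is_horn_sol B c (\<psi> l) \<and> fully_supported (\<psi> l)) \<and>
    (\<forall>l l' v. l \<noteq> l' \<longrightarrow> \<psi> l v = 0 \<or> \<psi> l' v = 0) \<and>
    (\<forall>l v. \<psi> l v \<noteq> 0 \<longrightarrow> f (c + mat_cvec B v) \<noteq> 0) \<and>
    f = (\<lambda>w. \<Sum>l\<in>{1..N}. subst_xB B c (\<psi> l) w)"
proof -
  define cls where "cls v l \<longleftrightarrow> (\<exists>u\<in>kerZ A. c + mat_cvec B v = \<alpha> + int_to_cvec u \<and> h u = l)" for v l
  define \<psi> where "\<psi> l v = (if cls v l then f (c + mat_cvec B v) else 0)" for l v
  have Bz: "B *v z \<in> kerZ A" for z
    by (simp add: kerZ_def matrix_vector_mul_assoc AB)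
  have cls_unique: "l = l'" if "cls v l" "cls v l'" for v l l'
    using that by (auto simp: cls_def int_to_cvec_inject)
  have cls_shift: "cls (v + int_to_cvec z) l" if "cls v l" for v z l
  proof -
    from that obtain u where u: "u \<in> kerZ A" "c + mat_cvec B v = \<alpha> + int_to_cvec u" "h u = l"
      unfolding cls_def by blast
    then have "c + mat_cvec B (v + int_to_cvec z) = \<alpha> + int_to_cvec (u + B *v z)"
      by (simp add: mat_cvec_add int_to_cvec_mult int_to_cvec_add flip: add.assoc)
    then show ?thesis
      unfolding cls_def using u h(2) Bz kerZ_add by blast
  qed
  have cls_axis: "cls (v - axis i 1) l \<longleftrightarrow> cls v l" for v i l
  proof -
    have "int_to_cvec (axis i 1) = axis i 1" "int_to_cvec (- axis i 1) = - axis i 1"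
      by (simp_all add: int_to_cvec_def axis_def vec_eq_iff)
    then show ?thesis
      using cls_shift[of v l "- axis i 1"] cls_shift[of "v - axis i 1" l "axis i 1"] by auto
  qed
  have f_supp: "\<exists>v u. w = c + mat_cvec B v \<and> u \<in> kerZ A \<and> w = \<alpha> + int_to_cvec u" if "f w \<noteq> 0" for w
  proof -
    have "mat_cvec A w = mat_cvec A c"
      using f(1) that by (auto simp: is_A_hyp_sol_def vec_eq_iff mat_cvec_def)
    then have "mat_cvec A (w - c) = 0" by (simp add: mat_cvec_diff)
    then obtain v where "w - c = mat_cvec B v" using ker by blast
    then have "w = c + mat_cvec B v" by (simp add: algebra_simps)
    moreover have "w \<in> supp f" using that by (simp add: supp_def)
    then obtain u where "u \<in> kerZ A" "w = \<alpha> + int_to_cvec u" using f(2) by blast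
    ultimately show ?thesis by blast
  qed
  \<comment> \<open>By \<open>cls_axis\<close> both terms of a Horn equation are kept or both are
    dropped.\<close>
  have "is_horn_sol B c (\<psi> l)" for l
    using A_hyp_sol_horn[OF f(1) AB] by (simp add: is_horn_sol_def \<psi>_def cls_axis)
  moreover have "fully_supported (\<psi> l)" if l: "l \<in> {1..N}" for l
  proof -
    obtain v0 u0 where w0: "w0 = c + mat_cvec B v0" "u0 \<in> kerZ A" "w0 = \<alpha> + int_to_cvec u0"
      using f_supp[OF f(3)] by blast
    obtain q where q: "q \<in> kerZ A" "h q = l" using h(3) l by blast
    \<comment> \<open>Adding \<open>r\<close> moves \<open>w0 = \<alpha> + u0\<close> to
      \<open>\<alpha> + q\<close>, which has label \<open>l\<close>.\<close>
    define r where "r = q - u0"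
    have r: "r \<in> kerZ A" using q(1) w0(2) by (simp add: r_def kerZ_diff)
    then obtain y where y: "int_to_cvec r = mat_cvec B y" using ker mat_cvec_kerZ by blast
    obtain d where d: "\<And>j. w0$j \<in> \<int> \<Longrightarrow> ((\<chi> j k. real_of_int (B$j$k)) *v d)$j = 1"
      using generic[of v0] w0(1) by blast
    show ?thesis
    proof (rule fully_supported_if_lattice_cone)
      show "((\<chi> j k. real_of_int (B$j$k)) *v d)$j = 1" if "j \<in> {j. w0$j \<in> \<int>}" for j
        using d that by simp
    next
      \<comment> \<open>The base point is \<open>v0 + y\<close> and the bounds are
        \<open>- r$j\<close>: they make \<open>r + B *v z\<close> nonnegative wherever
        \<open>w0\<close> has an integer coordinate, as \<open>A_hyp_sol_support\<close>
        requires.\<close>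
      fix z assume z: "\<And>j. j \<in> {j. w0$j \<in> \<int>} \<Longrightarrow> - r$j \<le> (B *v z)$j"
      have w: "c + mat_cvec B (v0 + y + int_to_cvec z) = w0 + int_to_cvec (r + B *v z)"
        by (simp add: mat_cvec_add int_to_cvec_mult int_to_cvec_add y w0(1) add.assoc)
      have "f (w0 + int_to_cvec (r + B *v z)) \<noteq> 0"
      proof (rule A_hyp_sol_support[OF f(1,3)])
        show "0 \<le> (r + B *v z)$j" if "w0$j \<in> \<int>" for j
          using z[of j] that by simp
      qed (use r Bz kerZ_add in blast)
      moreover have "w0 + int_to_cvec (r + B *v z) = \<alpha> + int_to_cvec (q + B *v z)"
        by (simp add: w0(3) r_def int_to_cvec_add int_to_cvec_diff)
      then have "cls (v0 + y + int_to_cvec z) l"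
        unfolding cls_def w using q h(2) Bz kerZ_add by blast
      ultimately show "\<psi> l (v0 + y + int_to_cvec z) \<noteq> 0"
        by (simp add: \<psi>_def w)
    qed
  qed
  moreover have "\<psi> l v = 0 \<or> \<psi> l' v = 0" if "l \<noteq> l'" for l l' v
    using cls_unique that by (auto simp: \<psi>_def)
  moreover have "f (c + mat_cvec B v) \<noteq> 0" if "\<psi> l v \<noteq> 0" for l v
    using that by (auto simp: \<psi>_def split: if_splits)
  moreover have "f w = (\<Sum>l\<in>{1..N}. subst_xB B c (\<psi> l) w)" for w
  proof (cases "f w = 0")
    case True
    have "subst_xB B c (\<psi> l) w = 0" for l
    proof (cases "\<exists>v. w = c + mat_cvec B v")
      case ex: True
      then obtain v where "w = c + mat_cvec B v" by blast
      with True show ?thesis by (simp add: subst_xB_apply[OF inj] \<psi>_def)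
    qed (simp add: subst_xB_def)
    with True show ?thesis by simp
  next
    case False
    then obtain v u where w: "w = c + mat_cvec B v" "u \<in> kerZ A" "w = \<alpha> + int_to_cvec u"
      using f_supp by blast
    then have "cls v (h u)" unfolding cls_def by metis
    then have "\<psi> l v = (if l = h u then f w else 0)" for l
      using cls_unique w(1) by (auto simp: \<psi>_def)
    then have "subst_xB B c (\<psi> l) w = (if l = h u then f w else 0)" for l
      using w(1) by (simp add: subst_xB_apply[OF inj])
    then show ?thesis using h(1)[of u] by simp
  qed
  ultimately show ?thesis by blast
qed

theorem theorem5p3:
  fixes A :: "int^'n^'d" and B :: "int^'m^'n"
  assumes "CARD('m) < CARD('n)"
    and "CARD('d) = CARD('n) - CARD('m)"
    and "rank (\<chi> j i. real_of_int (B$j$i)) = CARD('m)"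
    and "(\<Sum>j\<in>UNIV. B$j) = 0"
    and "rank (\<chi> k j. real_of_int (A$k$j)) = CARD('d)"
    and "\<exists>k0. \<forall>j. A$k0$j = 1"
    and "A ** B = 0"
  shows "\<exists>E::(complex^'n) set. E \<in> null_sets lborel \<and>
    (\<forall>c. c \<notin> E \<longrightarrow>
      (\<forall>\<phi> \<alpha> C. canonical_basis A c \<phi> \<alpha> C \<longrightarrow>
        (\<exists>\<psi> :: nat \<Rightarrow> nat \<Rightarrow> complex^'m \<Rightarrow> complex.
           let I = {1..volA A} \<times> {1..horn_g B} in
           (\<forall>(k,l)\<in>I. is_horn_sol B c (\<psi> k l) \<and> fully_supported (\<psi> k l)) \<and>
           lin_indep_on I (\<lambda>(k,l). \<psi> k l) \<and>
           (\<forall>(k,l)\<in>I. \<forall>(k',l')\<in>I. (k,l) \<noteq> (k',l') \<longrightarrow>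
               supp (\<psi> k l) \<inter> supp (\<psi> k' l') = {}) \<and>
           (\<forall>k\<in>{1..volA A}. \<phi> k = (\<lambda>w. \<Sum>l\<in>{1..horn_g B}. subst_xB B c (\<psi> k l) w)) \<and>
           (\<forall>\<mu>. (\<exists>i\<in>I. \<mu> i \<noteq> 0) \<longrightarrow>
               \<not> puiseux_poly (\<lambda>v. \<Sum>(k,l)\<in>I. \<mu> (k,l) * \<psi> k l v)))))"
proof -

  \<comment> \<open>Injectivity of \<open>B\<close> and the complex kernel of
    \<open>A\<close>\<close>
  define AR where "AR = (\<chi> k j. real_of_int (A$k$j))"
  define BR where "BR = (\<chi> j i. real_of_int (B$j$i))"
  have injR: "x = 0" if "BR *v x = 0" for x
    using assms(3) that full_rank_injective[of BR]
    by (metis BR_def injD matrix_vector_mult_0_right)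
  have injZ: "z = 0" if "B *v z = 0" for z
  proof -
    have "(BR *v (\<chi> i. of_int (z$i)))$j = of_int ((B *v z)$j)" for j
      by (simp add: BR_def matrix_vector_mult_def)
    then have "BR *v (\<chi> i. of_int (z$i)) = 0" using that by (simp add: vec_eq_iff)
    from injR[OF this] show ?thesis by (simp add: vec_eq_iff)
  qed
  have Re_Im: "(BR *v (\<chi> i. Re (v$i)))$j = Re (mat_cvec B v $ j)"
    "(BR *v (\<chi> i. Im (v$i)))$j = Im (mat_cvec B v $ j)" for v j
    by (simp_all add: BR_def matrix_vector_mult_def mat_cvec_def)
  have inj0: "v = 0" if "mat_cvec B v = 0" for v
  proof -
    have "BR *v (\<chi> i. Re (v$i)) = 0" "BR *v (\<chi> i. Im (v$i)) = 0"
      using that by (simp_all add: vec_eq_iff Re_Im)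
    from this[THEN injR] show ?thesis by (simp add: vec_eq_iff complex_eq_iff)
  qed
  have inj: "v = w" if "mat_cvec B v = mat_cvec B w" for v w
    using inj0[of "v - w"] that by (simp add: mat_cvec_diff)
  have ker: "\<exists>v. w = mat_cvec B v" if "mat_cvec A w = 0" for w
  \<comment> \<open>The real and imaginary parts of \<open>w\<close> are treated separately as
    kernel vectors of a real matrix.\<close>
  proof -
    have "(AR *v (\<chi> j. Re (w$j)))$k = Re (mat_cvec A w $ k)"
      "(AR *v (\<chi> j. Im (w$j)))$k = Im (mat_cvec A w $ k)" for k
      by (simp_all add: AR_def matrix_vector_mult_def mat_cvec_def)
    then have *: "AR *v (\<chi> j. Re (w$j)) = 0" "AR *v (\<chi> j. Im (w$j)) = 0"
      using that by (simp_all add: vec_eq_iff)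
    have "(AR ** BR)$k$i = of_int ((A ** B)$k$i)" for k i
      by (simp add: AR_def BR_def matrix_matrix_mult_def)
    then have "AR ** BR = 0" using assms(7) by (simp add: vec_eq_iff)
    moreover have "rank AR + rank BR = CARD('n)"
      using assms(1,2,3,5) by (simp add: AR_def BR_def)
    ultimately obtain x y where xy: "(\<chi> j. Re (w$j)) = BR *v x" "(\<chi> j. Im (w$j)) = BR *v y"
      using real_kernel_eq_range * by metis
    have "w $ j = mat_cvec B (\<chi> i. Complex (x$i) (y$i)) $ j" for j
      using xy by (simp add: complex_eq_iff vec_eq_iff flip: Re_Im)
    then show ?thesis by (metis vec_eq_iff)
  qed

  \<comment> \<open>The gcd of the maximal minors and the coset labels\<close>
  have dvd: "int (horn_g B) dvd det (\<chi> i k. B$(f i)$k)" for f :: "'m \<Rightarrow> 'n"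
  proof (cases "inj f")
    case True
    then show ?thesis unfolding horn_g_def by (simp add: Gcd_int_greater_eq_0) (blast intro: Gcd_dvd)
  next
    case False
    \<comment> \<open>\<open>horn_g\<close> ranges over injective row choices; a repeated row gives
      minor 0, so divisibility extends to every \<open>f\<close>.\<close>
    then obtain i j where "i \<noteq> j" "f i = f j" unfolding inj_def by blast
    then have "det (\<chi> i k. B$(f i)$k) = 0"
      by (intro det_identical_rows[of i j]) (auto simp: row_def)
    then show ?thesis by simp
  qed
  have "horn_g B > 0"
  proof (rule ccontr)
    assume "\<not> horn_g B > 0"
    then have "0 dvd det (\<chi> i k. B$(f i)$k)" for f :: "'m \<Rightarrow> 'n"
      using dvd[of f] by simp
    \<comment> \<open>For \<open>p = 0\<close> divisibility means vanishing, so the lemma yields a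
      nonzero integer kernel vector of \<open>B\<close>.\<close>
    then obtain x i where "x$i \<noteq> 0" "\<And>r. (B *v x)$r = 0"
      using exists_kernel_vector_mod[of 0 B] by (auto simp del: dvd_0_left_iff simp: dvd_0_left_iff[symmetric])
    then show False using injZ[of x] by (auto simp: vec_eq_iff)
  qed
  then obtain h :: "int^'n \<Rightarrow> nat" where h: "\<And>u. h u \<in> {1..horn_g B}" "\<And>u z. h (u + B *v z) = h u"
      "\<And>l. l \<in> {1..horn_g B} \<Longrightarrow> \<exists>q\<in>kerZ A. h q = l"
    using coset_labelling[OF _ dvd injZ assms(7)] by metis
  obtain E :: "(complex^'n) set" where E: "E \<in> null_sets lborel"
    "\<And>c v. c \<notin> E \<Longrightarrow> \<exists>d. \<forall>j. (c + mat_cvec B v)$j \<in> \<int> \<longrightarrow> ((\<chi> j k. real_of_int (B$j$k)) *v d)$j = 1"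
    using generic_parameters[of B] by metis
  show ?thesis
  proof (intro exI[of _ E] conjI allI impI E(1))
    fix c \<phi> \<alpha> C
    assume c: "c \<notin> E" and basis: "canonical_basis A c \<phi> \<alpha> C"
    define I where "I = {1..volA A} \<times> {1..horn_g B}"
    have sol: "is_A_hyp_sol A (mat_cvec A c) (\<phi> k)"
      and supp_\<phi>: "supp (\<phi> k) \<subseteq> {\<alpha> k + int_to_cvec u | u. u \<in> kerZ A}" if "k \<in> {1..volA A}" for k
      using basis that unfolding canonical_basis_def by blast+
    \<comment> \<open>Linear independence excludes a zero series and so supplies the exponent from
      which full support is propagated.\<close>
    have nonzero: "\<exists>w. \<phi> k w \<noteq> 0" if k: "k \<in> {1..volA A}" for k
    proof (rule ccontr)
      assume "\<nexists>w. \<phi> k w \<noteq> 0"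
      then have "(\<Sum>i\<in>{1..volA A}. (if i = k then 1 else 0) * \<phi> i w) = 0" for w
        by (intro sum.neutral) auto
      moreover have "lin_indep_on {1..volA A} \<phi>"
        using basis unfolding canonical_basis_def by blast
      ultimately have "\<forall>i\<in>{1..volA A}. (if i = k then 1 else 0) = (0::complex)"
        unfolding lin_indep_on_def by (elim allE[where x = "\<lambda>i. if i = k then 1 else 0"]) simp
      with k show False by (metis zero_neq_one)
    qed
    define dec where "dec k \<psi> \<longleftrightarrow> (\<forall>l\<in>{1..horn_g B}. is_horn_sol B c (\<psi> l) \<and> fully_supported (\<psi> l)) \<and>
        (\<forall>l l' v. l \<noteq> l' \<longrightarrow> \<psi> l v = 0 \<or> \<psi> l' v = 0) \<and>
        (\<forall>l v. \<psi> l v \<noteq> 0 \<longrightarrow> \<phi> k (c + mat_cvec B v) \<noteq> 0) \<and>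
        \<phi> k = (\<lambda>w. \<Sum>l\<in>{1..horn_g B}. subst_xB B c (\<psi> l) w)" for k \<psi>
    have "\<exists>\<psi>. dec k \<psi>" if k: "k \<in> {1..volA A}" for k
      unfolding dec_def
      using nonzero[OF k] horn_decomposition[OF assms(7) inj ker h E(2)[OF c] sol[OF k] supp_\<phi>[OF k]] by blast
    then obtain \<psi> where dec: "\<And>k. k \<in> {1..volA A} \<Longrightarrow> dec k (\<psi> k)" by metis
    have \<psi>:
      "\<And>k l. k \<in> {1..volA A} \<Longrightarrow> l \<in> {1..horn_g B} \<Longrightarrow> is_horn_sol B c (\<psi> k l) \<and> fully_supported (\<psi> k l)"
      "\<And>k l l' v. k \<in> {1..volA A} \<Longrightarrow> l \<noteq> l' \<Longrightarrow> \<psi> k l v = 0 \<or> \<psi> k l' v = 0"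
      "\<And>k l v. k \<in> {1..volA A} \<Longrightarrow> \<psi> k l v \<noteq> 0 \<Longrightarrow> \<phi> k (c + mat_cvec B v) \<noteq> 0"
      "\<And>k. k \<in> {1..volA A} \<Longrightarrow> \<phi> k = (\<lambda>w. \<Sum>l\<in>{1..horn_g B}. subst_xB B c (\<psi> k l) w)"
      using dec unfolding dec_def by blast+

    \<comment> \<open>Disjoint supports and linear combinations\<close>
    have disjoint: "(k, l) = (k', l')"
      if "(k, l) \<in> I" "(k', l') \<in> I" and v: "\<psi> k l v \<noteq> 0" "\<psi> k' l' v \<noteq> 0" for k l k' l' v
    proof -
      have k: "k \<in> {1..volA A}" "k' \<in> {1..volA A}" using that by (auto simp: I_def)
      have "c + mat_cvec B v \<in> supp (\<phi> k)" "c + mat_cvec B v \<in> supp (\<phi> k')"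
        using \<psi>(3) k v by (simp_all add: supp_def)
      then obtain u u' where "c + mat_cvec B v = \<alpha> k + int_to_cvec u" "c + mat_cvec B v = \<alpha> k' + int_to_cvec u'"
        using supp_\<phi> k by blast
      \<comment> \<open>A common exponent for different \<open>k\<close> would make the starting
        exponents differ by an integer vector, which a canonical basis forbids; for equal
        \<open>k\<close> the labels separate the supports.\<close>
      then have "\<alpha> k - \<alpha> k' = int_to_cvec (u' - u)"
        by (simp add: int_to_cvec_diff algebra_simps)
      then have "k = k'"
        using basis k unfolding canonical_basis_def by blast
      then show ?thesis using \<psi>(2) k v by metis
    qed
    have "finite I" by (simp add: I_def)
    \<comment> \<open>At an exponent of \<open>\<psi> k l\<close> all other summands vanish. This
      yields linear independence, and it shows that a combination with
      \<open>\<mu> (k, l) \<noteq> 0\<close> contains the infinite support of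
      \<open>\<psi> k l\<close>.\<close>
    have comb: "(\<Sum>i\<in>I. \<mu> i * (case i of (k, l) \<Rightarrow> \<psi> k l) v) = \<mu> (k, l) * \<psi> k l v"
      if kl: "(k, l) \<in> I" and v: "\<psi> k l v \<noteq> 0" for \<mu> k l v
    proof -
      have "(\<Sum>i\<in>I. \<mu> i * (case i of (k, l) \<Rightarrow> \<psi> k l) v) = (\<Sum>i\<in>{(k, l)}. \<mu> i * (case i of (k, l) \<Rightarrow> \<psi> k l) v)"
        by (rule sum.mono_neutral_right) (use \<open>finite I\<close> kl v disjoint in fastforce)+
      then show ?thesis by simp
    qed
    have infinite: "infinite (supp (\<psi> k l))" if "(k, l) \<in> I" for k l
      using \<psi>(1) that by (intro fully_supported_imp_infinite) (auto simp: I_def)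
    have indep: "lin_indep_on I (\<lambda>(k, l). \<psi> k l)"
      unfolding lin_indep_on_def
    proof (intro allI impI ballI)
      fix \<mu> i assume sum: "\<forall>v. (\<Sum>i\<in>I. \<mu> i * (case i of (k, l) \<Rightarrow> \<psi> k l) v) = 0" and "i \<in> I"
      obtain k l where kl: "i = (k, l)" by (cases i)
      with \<open>i \<in> I\<close> have I: "(k, l) \<in> I" by simp
      then obtain v where v: "\<psi> k l v \<noteq> 0"
        using infinite by (metis (mono_tags, lifting) Collect_empty_eq finite.emptyI supp_def)
      have "\<mu> (k, l) * \<psi> k l v = 0"
        using comb[OF I v, of \<mu>] spec[OF sum, of v] by (rule trans[OF sym])
      with v kl show "\<mu> i = 0" by simp
    qed
    have "\<not> puiseux_poly (\<lambda>v. \<Sum>(k, l)\<in>I. \<mu> (k, l) * \<psi> k l v)" if nz: "\<exists>i\<in>I. \<mu> i \<noteq> 0" for \<mu>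
    proof -
      obtain k l where kl: "(k, l) \<in> I" "\<mu> (k, l) \<noteq> 0" using nz by (metis surj_pair)
      have "(\<Sum>(k, l)\<in>I. \<mu> (k, l) * \<psi> k l v) = (\<Sum>i\<in>I. \<mu> i * (case i of (k, l) \<Rightarrow> \<psi> k l) v)" for v
        by (rule sum.cong) auto
      then have "supp (\<psi> k l) \<subseteq> supp (\<lambda>v. \<Sum>(k, l)\<in>I. \<mu> (k, l) * \<psi> k l v)"
        using kl comb by (auto simp: supp_def)
      then show ?thesis
        unfolding puiseux_poly_def using infinite[OF kl(1)] finite_subset by blast
    qed
    then have no_poly: "\<forall>\<mu>. (\<exists>i\<in>I. \<mu> i \<noteq> 0) \<longrightarrow> \<not> puiseux_poly (\<lambda>v. \<Sum>(k,l)\<in>I. \<mu> (k,l) * \<psi> k l v)"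
      by blast
    have disj: "\<forall>(k,l)\<in>I. \<forall>(k',l')\<in>I. (k,l) \<noteq> (k',l') \<longrightarrow> supp (\<psi> k l) \<inter> supp (\<psi> k' l') = {}"
      unfolding Ball_def split_paired_All prod.case supp_def using disjoint by blast
    have sols: "\<forall>(k,l)\<in>I. is_horn_sol B c (\<psi> k l) \<and> fully_supported (\<psi> k l)"
      unfolding I_def using \<psi>(1) by blast
    show "\<exists>\<psi> :: nat \<Rightarrow> nat \<Rightarrow> complex^'m \<Rightarrow> complex.
           let I = {1..volA A} \<times> {1..horn_g B} in
           (\<forall>(k,l)\<in>I. is_horn_sol B c (\<psi> k l) \<and> fully_supported (\<psi> k l)) \<and>
           lin_indep_on I (\<lambda>(k,l). \<psi> k l) \<and>
           (\<forall>(k,l)\<in>I. \<forall>(k',l')\<in>I. (k,l) \<noteq> (k',l') \<longrightarrow>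
               supp (\<psi> k l) \<inter> supp (\<psi> k' l') = {}) \<and>
           (\<forall>k\<in>{1..volA A}. \<phi> k = (\<lambda>w. \<Sum>l\<in>{1..horn_g B}. subst_xB B c (\<psi> k l) w)) \<and>
           (\<forall>\<mu>. (\<exists>i\<in>I. \<mu> i \<noteq> 0) \<longrightarrow>
               \<not> puiseux_poly (\<lambda>v. \<Sum>(k,l)\<in>I. \<mu> (k,l) * \<psi> k l v))"
      unfolding Let_def I_def[symmetric]
      by (intro exI[of _ \<psi>] conjI sols indep disj no_poly ballI \<psi>(4))
  qed
qed

end
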